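(* For every positive integer $N$, the function $V_{\mathrm{av}}^N(x)$ is convex for all $x>0$, and $$\lim_{x\to 0^+}\frac{d}{dx}V_{\mathrm{av}}^N(x)=-\frac2N.$$
   Context: For real $m>-1$ and $x>0$, $V_m(x)=\frac{2e^{x^2}}{\Gamma(m+1)}\int_x^\infty (t^2-x^2)^m e^{-t^2}\,dt=\frac{1}{\Gamma(m+1)}\int_0^\infty \frac{u^m e^{-u}}{\sqrt{x^2+u}}\,du$. For a positive integer $N$, $V_{\mathrm{av}}^N(x)=\frac1N\sum_{m=0}^{N-1}V_m(x)$. *)

theory Defs
  imports "HOL-Analysis.Analysis"
begin

(* Meaningful for m > -1 and x > 0, where the integrand is Lebesgue integrable.
   The integral runs over the open half-line because 0 powr 0 = 0. *)
definition V :: "real \<Rightarrow> real \<Rightarrow> real" where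
  "V m x = 2 * exp (x\<^sup>2) / Gamma (m + 1) *
     (LINT t:{x<..}|lborel. (t\<^sup>2 - x\<^sup>2) powr m * exp (- t\<^sup>2))"

definition V_av :: "nat \<Rightarrow> real \<Rightarrow> real" where
  "V_av N x = 1 / real N * (\<Sum>m<N. V (real m) x)"

end

theory Submission
  imports Defs
begin

text \<open>
  Let \<open>p\<^sub>m(u) = u\<^sup>m exp(-u) / m!\<close>. In the form \<open>V\<^sub>m(x) = \<integral>\<^sub>0\<^sup>\<infinity> p\<^sub>m(u) / sqrt(x\<^sup>2 + u) du\<close> the sum over
  \<open>m < N\<close> can be taken inside the integral, and the point is that the derivative of
  \<open>p\<^sub>0 + \<dots> + p\<^bsub>N-1\<^esub>\<close> telescopes to the single term \<open>-p\<^bsub>N-1\<^esub>\<close>. Integrating by parts against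
  \<open>2 sqrt(x\<^sup>2 + u)\<close> therefore gives, with \<open>H\<^sub>n(x) = \<integral>\<^sub>0\<^sup>\<infinity> p\<^sub>n(u) sqrt(x\<^sup>2 + u) du\<close>, the closed form
  \<open>N V_av N x = 2 (H\<^bsub>N-1\<^esub>(x) - x)\<close> (lemma \<open>V_av_eq_mean_dist\<close>), in which \<open>-2x\<close> is the boundary term
  at \<open>u = 0\<close>.

  Each \<open>x \<mapsto> sqrt(x\<^sup>2 + u)\<close> is the Euclidean norm of \<open>(x, sqrt u)\<close>, hence convex and
  1-Lipschitz. Convexity passes to the average \<open>H\<^sub>n\<close>, and the Lipschitz bound lets dominated
  convergence differentiate under the integral, so that
  \<open>H\<^sub>n'(x) = \<integral>\<^sub>0\<^sup>\<infinity> p\<^sub>n(u) x / sqrt(x\<^sup>2 + u) du\<close>. Here the factor of \<open>p\<^sub>n\<close> is bounded by 1 and vanishes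
  pointwise as \<open>x \<rightarrow> 0\<close>, so \<open>H\<^sub>n'(x) \<rightarrow> 0\<close>, and the whole limit \<open>-2/N\<close> comes from the boundary term.
\<close>

section \<open>Poisson weights\<close>

definition poisson_weight :: "nat \<Rightarrow> real \<Rightarrow> real" where
  "poisson_weight m u = u ^ m * exp (- u) / fact m"

lemma poisson_weight_nonneg: "u \<ge> 0 \<Longrightarrow> poisson_weight m u \<ge> 0"
  by (simp add: poisson_weight_def)

lemma continuous_on_poisson_weight: "continuous_on A (poisson_weight m)"
  unfolding poisson_weight_def by (intro continuous_intros) auto

lemma isCont_poisson_weight [continuous_intros]: "isCont (poisson_weight m) u"
  using continuous_on_poisson_weight[of UNIV m] by (simp add: continuous_on_eq_continuous_at)

lemma borel_measurable_poisson_weight [measurable]: "poisson_weight m \<in> borel_measurable borel"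
  by (intro borel_measurable_continuous_onI continuous_on_poisson_weight)

lemma times_poisson_weight: "u * poisson_weight m u = real (Suc m) * poisson_weight (Suc m) u"
  by (simp add: poisson_weight_def fact_Suc del: of_nat_Suc)

lemma tendsto_poisson_weight_at_top: "(poisson_weight m \<longlongrightarrow> 0) at_top"
proof -
  have "((\<lambda>u::real. u ^ m / exp u / fact m) \<longlongrightarrow> 0 / fact m) at_top"
    by (rule tendsto_divide[OF tendsto_power_div_exp_0 tendsto_const]) simp
  then show ?thesis
    by (simp add: poisson_weight_def[abs_def] exp_minus field_simps)
qed

text \<open>This is Euler's integral for the Gamma function at \<open>m + 1\<close>.\<close>

lemma set_integrable_poisson_weight: "set_integrable lborel {0<..} (poisson_weight m)"
proof -
  have "((\<lambda>u. u powr (real (m + 1) - 1) / exp u) has_integral Gamma (real (m + 1))) {0..}"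
    by (rule Gamma_integral_real) auto
  then have "(\<lambda>u. u powr (real (m + 1) - 1) / exp u) integrable_on {0..}"
    by blast
  then have "(\<lambda>u. u powr (real (m + 1) - 1) / exp u) absolutely_integrable_on {0..}"
    by (rule nonnegative_absolutely_integrable_1) auto
  then have "(\<lambda>u. u powr (real (m + 1) - 1) / exp u) absolutely_integrable_on {0<..}"
    by (rule set_integrable_subset) auto
  then have "set_integrable lborel {0<..} (\<lambda>u. u powr (real (m + 1) - 1) / exp u)"
    unfolding set_integrable_def by (subst (asm) integrable_completion) auto
  then have "set_integrable lborel {0<..} (\<lambda>u. u powr (real (m + 1) - 1) / exp u / fact m)"
    by (intro set_integrable_divide)
  also have "?this \<longleftrightarrow> ?thesis"
    by (rule set_integrable_cong[OF refl refl])
       (simp add: poisson_weight_def powr_realpow exp_minus field_simps)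
  finally show ?thesis .
qed

text \<open>
  Linear growth costs nothing, since multiplying \<open>p\<^sub>m\<close> by \<open>u\<close> only shifts \<open>m\<close>, up to a constant.
\<close>

lemma set_integrable_poisson_weight_times:
  assumes [measurable]: "k \<in> borel_measurable borel"
    and bound: "\<And>u. u > 0 \<Longrightarrow> \<bar>k u\<bar> \<le> a + b * u"
  shows "set_integrable lborel {0<..} (\<lambda>u. poisson_weight m u * k u)"
proof (rule set_integrable_bound)
  show "set_integrable lborel {0<..}
      (\<lambda>u. a * poisson_weight m u + b * real (Suc m) * poisson_weight (Suc m) u)"
    by (intro set_integral_add(1) set_integrable_mult_right set_integrable_poisson_weight)
  show "set_borel_measurable lborel {0<..} (\<lambda>u. poisson_weight m u * k u)"
    unfolding set_borel_measurable_def by measurable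
  have "norm (poisson_weight m u * k u)
      \<le> norm (a * poisson_weight m u + b * real (Suc m) * poisson_weight (Suc m) u)" if "u > 0" for u
  proof -
    have "\<bar>poisson_weight m u * k u\<bar> \<le> poisson_weight m u * (a + b * u)"
      using that bound[OF that] by (simp add: abs_mult poisson_weight_nonneg mult_left_mono)
    also have "\<dots> = a * poisson_weight m u + b * (u * poisson_weight m u)"
      by (simp add: algebra_simps)
    also have "\<dots> = a * poisson_weight m u + b * real (Suc m) * poisson_weight (Suc m) u"
      by (simp only: times_poisson_weight mult.assoc)
    finally show ?thesis
      by simp
  qed
  then show "AE u in lborel. u \<in> {0<..} \<longrightarrow> norm (poisson_weight m u * k u)
      \<le> norm (a * poisson_weight m u + b * real (Suc m) * poisson_weight (Suc m) u)"
    by auto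
qed

text \<open>
  Dominated convergence with the weight itself as majorant. The filter \<open>at x within S\<close> serves both
  the two-sided limit of a difference quotient and the one-sided limit at the origin.
\<close>

lemma tendsto_poisson_weight_integral:
  fixes k :: "real \<Rightarrow> real \<Rightarrow> real"
  assumes [measurable]: "\<And>y. k y \<in> borel_measurable borel" "l \<in> borel_measurable borel"
    and bound: "\<And>y u. y \<in> S - {x} \<Longrightarrow> u > 0 \<Longrightarrow> \<bar>k y u\<bar> \<le> 1"
    and lim: "\<And>u. u > 0 \<Longrightarrow> ((\<lambda>y. k y u) \<longlongrightarrow> l u) (at x within S)"
  shows "((\<lambda>y. LINT u:{0<..}|lborel. poisson_weight n u * k y u)
           \<longlongrightarrow> (LINT u:{0<..}|lborel. poisson_weight n u * l u)) (at x within S)"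
  unfolding tendsto_at_iff_sequentially comp_def set_lebesgue_integral_def
proof (intro allI impI)
  fix X :: "nat \<Rightarrow> real"
  assume X: "\<forall>i. X i \<in> S - {x}" "X \<longlonglongrightarrow> x"
  show "(\<lambda>i. LINT u|lborel. indicator {0<..} u *\<^sub>R (poisson_weight n u * k (X i) u))
      \<longlonglongrightarrow> (LINT u|lborel. indicator {0<..} u *\<^sub>R (poisson_weight n u * l u))"
  proof (rule integral_dominated_convergence)
    show "integrable lborel (\<lambda>u. indicator {0<..} u *\<^sub>R poisson_weight n u)"
      using set_integrable_poisson_weight by (simp add: set_integrable_def)
    have "(\<lambda>i. k (X i) u) \<longlonglongrightarrow> l u" if "u > 0" for u
      using lim[OF that] X by (simp add: tendsto_at_iff_sequentially comp_def)
    then show "AE u in lborel. (\<lambda>i. indicator {0<..} u *\<^sub>R (poisson_weight n u * k (X i) u))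
        \<longlonglongrightarrow> indicator {0<..} u *\<^sub>R (poisson_weight n u * l u)"
      by (auto intro!: AE_I2 tendsto_intros split: split_indicator)
    show "AE u in lborel. norm (indicator {0<..} u *\<^sub>R (poisson_weight n u * k (X i) u))
        \<le> indicator {0<..} u *\<^sub>R poisson_weight n u" for i
      using X(1) bound[of "X i"]
      by (auto intro!: AE_I2 mult_left_le simp: abs_mult poisson_weight_nonneg split: split_indicator)
  qed auto
qed

text \<open>
  The derivative of \<open>p\<^sub>m\<close> is \<open>p\<^bsub>m-1\<^esub> - p\<^sub>m\<close>, where \<open>p\<^bsub>-1\<^esub> = 0\<close>, so the sum telescopes. In probabilistic terms, the
  sum is the probability that the arrival time with density \<open>p\<^sub>n\<close> exceeds \<open>u\<close>.
\<close>

lemma has_real_derivative_sum_poisson_weight: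
  "((\<lambda>u. \<Sum>m<Suc n. poisson_weight m u) has_real_derivative - poisson_weight n u) (at u)"
proof (induction n)
  case 0
  show ?case
    by (auto simp: poisson_weight_def intro!: derivative_eq_intros)
next
  case (Suc n)
  have "(poisson_weight (Suc n) has_real_derivative
      (real (Suc n) * u ^ n * exp (- u) - u ^ Suc n * exp (- u)) / fact (Suc n)) (at u)"
    unfolding poisson_weight_def[abs_def]
    by (rule derivative_eq_intros refl | simp)+
  also have "(real (Suc n) * u ^ n * exp (- u) - u ^ Suc n * exp (- u)) / fact (Suc n)
      = poisson_weight n u - poisson_weight (Suc n) u"
    by (simp add: poisson_weight_def field_simps del: of_nat_Suc)
  finally show ?case
    using DERIV_add[OF Suc.IH] by (subst sum.lessThan_Suc) fastforce
qed

section \<open>The distance kernel\<close>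

text \<open>
  Reading \<open>sqrt(x\<^sup>2 + u)\<close> as a norm in the plane yields convexity and the Lipschitz bound from the
  triangle inequality.
\<close>

lemma sqrt_add_eq_norm: "u \<ge> 0 \<Longrightarrow> sqrt (x\<^sup>2 + u) = norm (x, sqrt u)" for x u :: real
  by (simp add: norm_Pair)

lemma convex_on_sqrt_add:
  fixes u :: real
  assumes "u \<ge> 0"
  shows "convex_on UNIV (\<lambda>x. sqrt (x\<^sup>2 + u))"
proof (rule convex_onI)
  fix t x y :: real
  assume t: "0 < t" "t < 1"
  have "sqrt (((1 - t) *\<^sub>R x + t *\<^sub>R y)\<^sup>2 + u)
      = norm ((1 - t) *\<^sub>R (x, sqrt u) + t *\<^sub>R (y, sqrt u))"
    using assms by (simp add: norm_Pair algebra_simps)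
  also have "\<dots> \<le> norm ((1 - t) *\<^sub>R (x, sqrt u)) + norm (t *\<^sub>R (y, sqrt u))"
    by (rule norm_triangle_ineq)
  also have "\<dots> = (1 - t) * norm (x, sqrt u) + t * norm (y, sqrt u)"
    using t by (simp only: norm_scaleR)
  finally show "sqrt (((1 - t) *\<^sub>R x + t *\<^sub>R y)\<^sup>2 + u)
      \<le> (1 - t) * sqrt (x\<^sup>2 + u) + t * sqrt (y\<^sup>2 + u)"
    using assms by (simp add: sqrt_add_eq_norm)
qed auto

lemma sqrt_add_lipschitz:
  fixes u :: real
  assumes "u \<ge> 0"
  shows "\<bar>sqrt (y\<^sup>2 + u) - sqrt (x\<^sup>2 + u)\<bar> \<le> \<bar>y - x\<bar>"
  using norm_triangle_ineq3[of "(y, sqrt u)" "(x, sqrt u)"] assms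
  by (simp add: sqrt_add_eq_norm)

lemma sqrt_add_le: "u \<ge> 0 \<Longrightarrow> sqrt (x\<^sup>2 + u) \<le> (\<bar>x\<bar> + 1) + 1 * u" for x u :: real
  by (rule real_le_lsqrt) (auto simp: power2_eq_square algebra_simps)

lemma has_real_derivative_sqrt_add:
  fixes x u :: real
  assumes "u > 0"
  shows "((\<lambda>x. sqrt (x\<^sup>2 + u)) has_real_derivative x / sqrt (x\<^sup>2 + u)) (at x)"
proof -
  have "x\<^sup>2 + u > 0"
    using assms by (simp add: add_nonneg_pos)
  then show ?thesis
    by (auto intro!: derivative_eq_intros simp: field_simps)
qed

section \<open>The averaged distance\<close>

text \<open>
  This is the \<open>H\<^sub>n\<close> of the overview: the mean distance from the origin to \<open>(x, sqrt u)\<close> when \<open>u\<close> is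
  random with density \<open>p\<^sub>n\<close>.
\<close>

definition mean_dist :: "nat \<Rightarrow> real \<Rightarrow> real" where
  "mean_dist n x = (LINT u:{0<..}|lborel. poisson_weight n u * sqrt (x\<^sup>2 + u))"

lemma set_integrable_mean_dist:
  "set_integrable lborel {0<..} (\<lambda>u. poisson_weight n u * sqrt (x\<^sup>2 + u))"
  by (rule set_integrable_poisson_weight_times[where a = "\<bar>x\<bar> + 1" and b = 1])
     (auto intro: sqrt_add_le[simplified])

lemma convex_on_mean_dist: "convex_on UNIV (mean_dist n)"
proof (rule convex_onI)
  fix t x y :: real
  assume t: "0 < t" "t < 1"
  let ?f = "\<lambda>x u. poisson_weight n u * sqrt (x\<^sup>2 + u)"
  have int: "set_integrable lborel {0<..} (\<lambda>u. (1 - t) * ?f x u)"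
      "set_integrable lborel {0<..} (\<lambda>u. t * ?f y u)"
    using t by (simp_all add: set_integrable_mean_dist)
  have "mean_dist n ((1 - t) *\<^sub>R x + t *\<^sub>R y)
      \<le> (LINT u:{0<..}|lborel. (1 - t) * ?f x u + t * ?f y u)"
    unfolding mean_dist_def
  proof (rule set_integral_mono)
    fix u :: real
    assume "u \<in> {0<..}"
    then have u: "u \<ge> 0"
      by simp
    have "sqrt (((1 - t) *\<^sub>R x + t *\<^sub>R y)\<^sup>2 + u) \<le> (1 - t) * sqrt (x\<^sup>2 + u) + t * sqrt (y\<^sup>2 + u)"
      using convex_onD[OF convex_on_sqrt_add[OF u], of t x y] t by simp
    from mult_left_mono[OF this poisson_weight_nonneg[OF u, of n]]
    show "?f ((1 - t) *\<^sub>R x + t *\<^sub>R y) u \<le> (1 - t) * ?f x u + t * ?f y u"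
      by (simp add: algebra_simps)
  qed (intro set_integrable_mean_dist set_integral_add int)+
  also have "\<dots> = (1 - t) * mean_dist n x + t * mean_dist n y"
    using int by (simp add: mean_dist_def)
  finally show "mean_dist n ((1 - t) *\<^sub>R x + t *\<^sub>R y)
      \<le> (1 - t) * mean_dist n x + t * mean_dist n y" .
qed auto

text \<open>The difference quotients of the kernel are bounded by its Lipschitz constant 1.\<close>

lemma has_real_derivative_mean_dist:
  "(mean_dist n has_real_derivative
     (LINT u:{0<..}|lborel. poisson_weight n u * (x / sqrt (x\<^sup>2 + u)))) (at x)"
proof -
  let ?k = "\<lambda>y u. (sqrt (y\<^sup>2 + u) - sqrt (x\<^sup>2 + u)) / (y - x)"
  have "(LINT u:{0<..}|lborel. poisson_weight n u * ?k y u)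
      = (mean_dist n y - mean_dist n x) / (y - x)" for y
  proof -
    have "(LINT u:{0<..}|lborel. poisson_weight n u * ?k y u)
        = (LINT u:{0<..}|lborel. (poisson_weight n u * sqrt (y\<^sup>2 + u)
            - poisson_weight n u * sqrt (x\<^sup>2 + u)) / (y - x))"
      by (simp add: right_diff_distrib)
    then show ?thesis
      by (simp add: mean_dist_def set_integrable_mean_dist set_integral_diff(2))
  qed
  moreover have "((\<lambda>y. LINT u:{0<..}|lborel. poisson_weight n u * ?k y u) \<longlongrightarrow>
      (LINT u:{0<..}|lborel. poisson_weight n u * (x / sqrt (x\<^sup>2 + u)))) (at x)"
  proof (rule tendsto_poisson_weight_integral)
    show "\<bar>?k y u\<bar> \<le> 1" if "y \<in> UNIV - {x}" "u > 0" for y u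
      using sqrt_add_lipschitz[of u y x] that by (simp add: divide_le_eq)
    show "((\<lambda>y. ?k y u) \<longlongrightarrow> x / sqrt (x\<^sup>2 + u)) (at x)" if "u > 0" for u
      using has_real_derivative_sqrt_add[OF that, of x] by (simp add: has_field_derivative_iff)
  qed auto
  ultimately show ?thesis
    by (simp only: has_field_derivative_iff)
qed

lemma tendsto_mean_dist_derivative:
  "((\<lambda>x. LINT u:{0<..}|lborel. poisson_weight n u * (x / sqrt (x\<^sup>2 + u))) \<longlongrightarrow> 0) (at 0 within S)"
proof -
  have "((\<lambda>x. LINT u:{0<..}|lborel. poisson_weight n u * (x / sqrt (x\<^sup>2 + u)))
      \<longlongrightarrow> (LINT u:{0<..}|lborel. poisson_weight n u * 0)) (at 0 within S)"
  proof (rule tendsto_poisson_weight_integral)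
    fix x u :: real
    assume "u > 0"
    then have "\<bar>x\<bar> \<le> sqrt (x\<^sup>2 + u)" "sqrt (x\<^sup>2 + u) > 0"
      by (auto intro: real_le_rsqrt add_nonneg_pos)
    then show "\<bar>x / sqrt (x\<^sup>2 + u)\<bar> \<le> 1"
      by (simp add: divide_le_eq)
  next
    fix u :: real
    assume "u > 0"
    then show "((\<lambda>x. x / sqrt (x\<^sup>2 + u)) \<longlongrightarrow> 0) (at 0 within S)"
      by (auto intro!: tendsto_eq_intros)
  qed auto
  then show ?thesis
    by simp
qed

section \<open>Closed form of the average\<close>

lemma set_integrable_poisson_weight_inverse_sqrt:
  assumes "x > 0"
  shows "set_integrable lborel {0<..} (\<lambda>u. poisson_weight m u * (1 / sqrt (x\<^sup>2 + u)))"
proof (rule set_integrable_poisson_weight_times[where a = "1 / x" and b = 0])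
  fix u :: real
  assume "u > 0"
  then have "x \<le> sqrt (x\<^sup>2 + u)"
    by (auto intro: real_le_rsqrt)
  then show "\<bar>1 / sqrt (x\<^sup>2 + u)\<bar> \<le> 1 / x + 0 * u"
    using assms by (simp add: frac_le)
qed auto

text \<open>Substitute \<open>t = sqrt(x\<^sup>2 + u)\<close>, so that the parameter leaves the domain of integration.\<close>

lemma V_eq_poisson_weight_integral:
  assumes x: "x > 0"
  shows "V (real m) x = (LINT u:{0<..}|lborel. poisson_weight m u * (1 / sqrt (x\<^sup>2 + u)))"
proof -
  let ?f = "\<lambda>t. (t\<^sup>2 - x\<^sup>2) powr real m * exp (- t\<^sup>2)"
  let ?g = "\<lambda>u. sqrt (x\<^sup>2 + u)"
  let ?g' = "\<lambda>u. 1 / (2 * sqrt (x\<^sup>2 + u))"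
  let ?c = "fact m * exp (- x\<^sup>2) / 2 :: real"
  have pos: "x\<^sup>2 + u > 0" if "u \<ge> 0" for u
    using x that by (simp add: add_pos_nonneg)
  have subst: "?f (?g u) * ?g' u = ?c * (poisson_weight m u * (1 / sqrt (x\<^sup>2 + u)))" if "u > 0" for u
    using that pos[of u] by (simp add: poisson_weight_def powr_realpow exp_diff exp_minus field_simps exp_add)
  have "(LBINT t=ereal x..\<infinity>. ?f t) = (LBINT u=ereal 0..\<infinity>. ?f (?g u) * ?g' u)"
  proof (rule interval_integral_substitution_nonneg)
    fix u :: real
    assume "ereal 0 < ereal u"
    then have u: "u > 0"
      by simp
    show "(?g has_real_derivative ?g' u) (at u)"
      using pos[of u] u by (auto intro!: derivative_eq_intros simp: field_simps)
    show "isCont ?f (?g u)"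
      using pos[of u] u by (auto intro!: continuous_intros)
    show "isCont ?g' u"
      using pos[of u] u by (auto intro!: continuous_intros)
  next
    have "(?g \<longlongrightarrow> x) (at_right 0)"
      using x by (auto intro!: tendsto_eq_intros)
    then show "((ereal \<circ> ?g \<circ> real_of_ereal) \<longlongrightarrow> ereal x) (at_right (ereal 0))"
      by (simp add: ereal_tendsto_simps)
    have "filterlim ?g at_top at_top"
      by (intro filterlim_compose[OF sqrt_at_top]
          filterlim_tendsto_add_at_top[OF tendsto_const filterlim_ident])
    then show "((ereal \<circ> ?g \<circ> real_of_ereal) \<longlongrightarrow> \<infinity>) (at_left \<infinity>)"
      by (simp add: ereal_tendsto_simps)
    have "set_integrable lborel {0<..} (\<lambda>u. ?c * (poisson_weight m u * (1 / sqrt (x\<^sup>2 + u))))"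
      by (intro set_integrable_mult_right set_integrable_poisson_weight_inverse_sqrt x)
    then show "set_integrable lborel (einterval (ereal 0) \<infinity>) (\<lambda>u. ?f (?g u) * ?g' u)"
      by (subst set_integrable_cong[OF refl _ subst, of _ "{0<..}"]) auto
  qed (auto simp: pos less_imp_le)
  also have "\<dots> = (LINT u:{0<..}|lborel. ?c * (poisson_weight m u * (1 / sqrt (x\<^sup>2 + u))))"
    unfolding interval_integral_to_infinity_eq
    by (rule set_lebesgue_integral_cong) (use subst in auto)
  finally have "(LINT t:{x<..}|lborel. ?f t)
      = ?c * (LINT u:{0<..}|lborel. poisson_weight m u * (1 / sqrt (x\<^sup>2 + u)))"
    by (simp only: interval_integral_to_infinity_eq set_integral_mult_right)
  moreover have "Gamma (real m + 1) = fact m"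
    using Gamma_fact[of m] by (simp add: add.commute)
  ultimately show ?thesis
    by (simp only: V_def) (simp add: exp_minus)
qed

text \<open>
  Integration by parts: \<open>2 Q sqrt(x\<^sup>2 + u)\<close> with \<open>Q = p\<^sub>0 + \<dots> + p\<^sub>n\<close> is a primitive of
  \<open>Q / sqrt(x\<^sup>2 + u) - 2 p\<^sub>n sqrt(x\<^sup>2 + u)\<close>; it equals \<open>2x\<close> at the origin and vanishes at infinity.
\<close>

lemma sum_V_eq_mean_dist:
  assumes x: "x > 0"
  shows "(\<Sum>m<Suc n. V (real m) x) = 2 * (mean_dist n x - x)"
proof -
  let ?Q = "\<lambda>u. \<Sum>m<Suc n. poisson_weight m u"
  let ?r = "\<lambda>u. sqrt (x\<^sup>2 + u)"
  let ?h = "\<lambda>u. ?Q u * (1 / ?r u)"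
  let ?F = "\<lambda>u. 2 * (?Q u * ?r u)"
  let ?F' = "\<lambda>u. ?h u - 2 * (poisson_weight n u * ?r u)"
  have sum_int: "(\<lambda>u. indicator {0<..} u *\<^sub>R ?h u)
      = (\<lambda>u. \<Sum>m<Suc n. indicator {0<..} u *\<^sub>R (poisson_weight m u * (1 / ?r u)))"
    by (simp only: sum_distrib_right scaleR_sum_right)
  have integrable: "integrable lborel (\<lambda>u. indicator {0<..} u *\<^sub>R (poisson_weight m u * (1 / ?r u)))" for m
    using set_integrable_poisson_weight_inverse_sqrt[OF x] by (simp add: set_integrable_def)
  have h: "set_integrable lborel {0<..} ?h"
    unfolding set_integrable_def sum_int by (intro Bochner_Integration.integrable_sum integrable)
  have sum_V: "(\<Sum>m<Suc n. V (real m) x) = (LINT u:{0<..}|lborel. ?h u)"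
    unfolding V_eq_poisson_weight_integral[OF x] set_lebesgue_integral_def sum_int
    by (rule Bochner_Integration.integral_sum[symmetric]) (rule integrable)
  have H: "set_integrable lborel {0<..} (\<lambda>u. 2 * (poisson_weight n u * ?r u))"
    by (intro set_integrable_mult_right set_integrable_mean_dist)

  have "(LBINT u=ereal 0..\<infinity>. ?F' u) = 0 - 2 * x"
  proof (rule interval_integral_FTC_integrable)
    fix u :: real
    assume "ereal 0 < ereal u"
    then have u: "u > 0" "x\<^sup>2 + u > 0"
      by (auto simp: add_nonneg_pos)
    have "(?r has_real_derivative 1 / (2 * ?r u)) (at u)"
      using u by (auto intro!: derivative_eq_intros simp: field_simps)
    from DERIV_cmult[OF DERIV_mult[OF has_real_derivative_sum_poisson_weight[of n u] this], of 2]
    have "(?F has_real_derivative ?F' u) (at u)"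
      by (rule DERIV_cong) (simp add: algebra_simps del: sum.lessThan_Suc)
    then show "(?F has_vector_derivative ?F' u) (at u)"
      by (simp only: has_real_derivative_iff_has_vector_derivative)
    show "isCont ?F' u"
      using u by (intro continuous_intros) auto
  next
    show "set_integrable lborel (einterval (ereal 0) \<infinity>) ?F'"
      using set_integral_diff(1)[OF h H] by (simp del: sum.lessThan_Suc)
    \<comment> \<open>Only the weight \<open>m = 0\<close> survives at the origin, with value 1.\<close>
    have "?Q 0 = 1"
      by (simp add: poisson_weight_def sum.lessThan_Suc_shift del: sum.lessThan_Suc)
    moreover have "isCont ?F 0"
      by (intro continuous_intros)
    ultimately have "(?F \<longlongrightarrow> 2 * x) (at 0)"
      using x by (simp add: isCont_def del: sum.lessThan_Suc)
    then show "((?F \<circ> real_of_ereal) \<longlongrightarrow> 2 * x) (at_right (ereal 0))"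
      unfolding ereal_tendsto_simps by (rule filterlim_mono) (auto intro: at_le)
    have "((\<lambda>u. poisson_weight m u * ?r u) \<longlongrightarrow> 0) at_top" for m
    proof (rule Lim_null_comparison)
      have "norm (poisson_weight m u * ?r u)
          \<le> (\<bar>x\<bar> + 1) * poisson_weight m u + real (Suc m) * poisson_weight (Suc m) u" if "u > 0" for u
      proof -
        have "norm (poisson_weight m u * ?r u) \<le> poisson_weight m u * (\<bar>x\<bar> + 1 + 1 * u)"
          using that sqrt_add_le[of u x] poisson_weight_nonneg[of u m]
          by (simp add: abs_mult mult_left_mono)
        also have "\<dots> = (\<bar>x\<bar> + 1) * poisson_weight m u + u * poisson_weight m u"
          by (simp add: algebra_simps)
        finally show ?thesis
          by (simp only: times_poisson_weight)
      qed
      then show "\<forall>\<^sub>F u in at_top. norm (poisson_weight m u * ?r u)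
          \<le> (\<bar>x\<bar> + 1) * poisson_weight m u + real (Suc m) * poisson_weight (Suc m) u"
        by (intro eventually_mono[OF eventually_gt_at_top[of 0]])
      show "((\<lambda>u. (\<bar>x\<bar> + 1) * poisson_weight m u + real (Suc m) * poisson_weight (Suc m) u)
          \<longlongrightarrow> 0) at_top"
        by (rule tendsto_eq_intros tendsto_poisson_weight_at_top refl | simp)+
    qed
    then have "((\<lambda>u. 2 * (\<Sum>m<Suc n. poisson_weight m u * ?r u)) \<longlongrightarrow> 2 * (\<Sum>m<Suc n. 0)) at_top"
      by (intro tendsto_intros)
    then show "((?F \<circ> real_of_ereal) \<longlongrightarrow> 0) (at_left \<infinity>)"
      by (simp add: ereal_tendsto_simps sum_distrib_right del: sum.lessThan_Suc)
  qed simp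
  then have "(LINT u:{0<..}|lborel. ?h u) - 2 * mean_dist n x = - 2 * x"
    using h H
    by (simp add: interval_integral_to_infinity_eq mean_dist_def del: sum.lessThan_Suc)
  then show ?thesis
    by (simp add: sum_V del: sum.lessThan_Suc)
qed

lemma V_av_eq_mean_dist:
  assumes "x > 0" "N > 0"
  shows "V_av N x = 2 / real N * (mean_dist (N - 1) x - x)"
  using sum_V_eq_mean_dist[OF assms(1), of "N - 1"] assms(2) by (simp add: V_av_def)

theorem proposition11:
  fixes N :: nat
  assumes "N > 0"
  shows "convex_on {0<..} (V_av N) \<and>
    (\<forall>x>0. V_av N differentiable (at x)) \<and>
    ((\<lambda>x. deriv (V_av N) x) \<longlongrightarrow> - 2 / real N) (at_right 0)"
proof (intro conjI)
  let ?G = "\<lambda>x. 2 / real N * (mean_dist (N - 1) x + - x)"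
  let ?D = "\<lambda>x. LINT u:{0<..}|lborel. poisson_weight (N - 1) u * (x / sqrt (x\<^sup>2 + u))"
  have eq: "V_av N x = ?G x" if "x > 0" for x
    using V_av_eq_mean_dist[OF that assms] by simp
  have "convex_on {0<..} ?G"
    by (intro convex_on_cmul convex_on_add convex_on_subset[OF convex_on_mean_dist])
       (auto intro!: convex_onI simp: algebra_simps)
  moreover have "u *\<^sub>R x + v *\<^sub>R y > 0" if "x > 0" "y > 0" "u \<ge> 0" "v \<ge> 0" "u + v = 1" for u v x y :: real
    using convexD[of "{0::real<..}" x y u v] that by simp
  ultimately show "convex_on {0<..} (V_av N)"
    unfolding convex_on_def by (auto simp: eq)

  \<comment> \<open>The half-line is open, so agreement with the closed form there transfers derivatives.\<close>
  have deriv: "(V_av N has_real_derivative 2 / real N * (?D x + - 1)) (at x)" if "x > 0" for x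
  proof (rule has_field_derivative_transform_within_open)
    show "(?G has_real_derivative 2 / real N * (?D x + - 1)) (at x)"
      by (intro DERIV_cmult DERIV_add has_real_derivative_mean_dist DERIV_minus DERIV_ident)
  qed (use that eq in \<open>auto intro: open_greaterThan\<close>)
  then show "\<forall>x>0. V_av N differentiable (at x)"
    using real_differentiable_def by blast

  have "((\<lambda>x. 2 / real N * (?D x + - 1)) \<longlongrightarrow> 2 / real N * (0 + - 1)) (at_right 0)"
    by (intro tendsto_intros tendsto_mean_dist_derivative)
  then have lim: "((\<lambda>x. 2 / real N * (?D x + - 1)) \<longlongrightarrow> - 2 / real N) (at_right 0)"
    by simp
  have "2 / real N * (?D x + - 1) = deriv (V_av N) x" if "x \<in> {0<..<1}" for x
    using DERIV_imp_deriv[OF deriv[of x]] that by (simp only: greaterThanLessThan_iff)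
  then have "\<forall>\<^sub>F x in at_right 0. 2 / real N * (?D x + - 1) = deriv (V_av N) x"
    by (rule eventually_at_rightI[of 0 1]) simp_all
  with lim show "((\<lambda>x. deriv (V_av N) x) \<longlongrightarrow> - 2 / real N) (at_right 0)"
    by (rule Lim_transform_eventually)
qed

end
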